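(* Let $\mu,\nu$ be finite positive Borel measures on $\mathbb{R}^d$ such that all moments of $\mu$ and $\nu$ are finite and such that, for some scalar $c>0$, $\int \exp(c|x_i|)\,d\mu<\infty$ and $\int \exp(c|x_i|)\,d\nu<\infty$ for all $i=1,\ldots,d$. For each $n\in\mathbb{N}$ let $$\rho_n=\min_{\boldsymbol{\phi},\boldsymbol{\psi}}\Big\{\phi_{\mathbf 0}+\psi_{\mathbf 0}:\ \phi_{\boldsymbol{\alpha}}-\psi_{\boldsymbol{\alpha}}=\mu_{\boldsymbol{\alpha}}-\nu_{\boldsymbol{\alpha}}\ \ \forall\boldsymbol{\alpha}\in\mathbb{N}^d_{2n};\quad 0\preceq \mathbf{M}_n(\boldsymbol{\phi})\preceq \mathbf{M}_n(\mu);\quad 0\preceq \mathbf{M}_n(\boldsymbol{\psi})\preceq \mathbf{M}_n(\nu)\Big\},$$ where the minimum is over real vectors $\boldsymbol{\phi}=(\phi_{\boldsymbol{\alpha}})_{\boldsymbol{\alpha}\in\mathbb{N}^d_{2n}}$, $\boldsymbol{\psi}=(\psi_{\boldsymbol{\alpha}})_{\boldsymbol{\alpha}\in\mathbb{N}^d_{2n}}$, and let $$\rho^*_n=\sup_{p,\sigma_0,\sigma_1,\psi_0,\psi_1}\Big\{\int p\,d(\mu-\nu)-\int\sigma_1\,d\mu-\int\psi_1\,d\nu:\ 1-p=\sigma_0-\sigma_1;\ 1+p=\psi_0-\psi_1;\ p\in\mathbb{R}[\mathbf{x}]_{2n};\ \sigma_0,\sigma_1,\psi_0,\psi_1\in\Sigma[\mathbf{x}]_n\Big\}.$$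 Then the second problem is a dual of the first, i.e., $\rho_n\ge\rho^*_n$ for every $n$.
   Context: $\mathbb{N}^d_n=\{\boldsymbol{\alpha}\in\mathbb{N}^d:\sum_i\alpha_i\le n\}$. $\mathbb{R}[\mathbf{x}]_{k}$ is the set of real polynomials in $d$ variables of total degree at most $k$; $\Sigma[\mathbf{x}]_n\subset\mathbb{R}[\mathbf{x}]_{2n}$ is the convex cone of sums of squares of polynomials having total degree at most $2n$. For a measure $\mu$ with finite moments, $\mu_{\boldsymbol{\alpha}}=\int \mathbf{x}^{\boldsymbol{\alpha}}\,d\mu$. For a real vector $\boldsymbol{\phi}=(\phi_{\boldsymbol{\alpha}})_{\boldsymbol{\alpha}\in\mathbb{N}^d_{2n}}$, the moment matrix $\mathbf{M}_n(\boldsymbol{\phi})$ has rows and columns indexed by $\mathbb{N}^d_n$ and entries $\mathbf{M}_n(\boldsymbol{\phi})(\boldsymbol{\alpha},\boldsymbol{\beta})=\phi_{\boldsymbol{\alpha}+\boldsymbol{\beta}}$; $\mathbf{M}_n(\mu)$ is the moment matrix of the moments of $\mu$ up to degree $2n$. $\mathbf{A}\succeq0$ means positive semidefinite, and $\mathbf{A}\preceq\mathbf{B}$ means $\mathbf{B}-\mathbf{A}\succeq0$. In the dual problem $\psi_0,\psi_1$ denote polynomials, unrelated to the vector $\boldsymbol{\psi}$ of the primal problem. *)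

theory Defs
  imports "HOL-Analysis.Analysis" "HOL-Library.Poly_Mapping"
begin

text \<open>
  The type \<open>'n\<close> indexes the variables, so the dimension is \<open>CARD('n)\<close>.
  A multi-index is an element of \<open>'n \<Rightarrow>\<^sub>0 nat\<close>, and a polynomial is the finitely
  supported map from multi-indices to coefficients; the ring structure is the convolution
  product of \<open>Poly_Mapping\<close>.
\<close>

type_synonym 'n multi_index = "'n \<Rightarrow>\<^sub>0 nat"

type_synonym 'n rpoly = "('n \<Rightarrow>\<^sub>0 nat) \<Rightarrow>\<^sub>0 real"

definition multi_indices :: "nat \<Rightarrow> ('n::finite) multi_index set" where
  "multi_indices n = {\<alpha>. (\<Sum>i\<in>UNIV. Poly_Mapping.lookup \<alpha> i) \<le> n}"

definition monomial_at :: "('n::finite) multi_index \<Rightarrow> real ^ 'n \<Rightarrow> real" where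
  "monomial_at \<alpha> x = (\<Prod>i\<in>UNIV. (x $ i) ^ Poly_Mapping.lookup \<alpha> i)"

definition poly_at :: "('n::finite) rpoly \<Rightarrow> real ^ 'n \<Rightarrow> real" where
  "poly_at p x = (\<Sum>\<alpha>\<in>Poly_Mapping.keys p. Poly_Mapping.lookup p \<alpha> * monomial_at \<alpha> x)"

definition polys_deg_le :: "nat \<Rightarrow> ('n::finite) rpoly set" where
  "polys_deg_le k = {p. Poly_Mapping.keys p \<subseteq> multi_indices k}"

text \<open>The degree bound \<open>2 * n\<close> is imposed on the sum, not on the individual squares.\<close>

definition sos_polys :: "nat \<Rightarrow> ('n::finite) rpoly set" where
  "sos_polys n = {\<sigma> \<in> polys_deg_le (2 * n). \<exists>qs. \<sigma> = (\<Sum>q\<leftarrow>qs. q ^ 2)}"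

definition moment :: "(real ^ 'n) measure \<Rightarrow> ('n::finite) multi_index \<Rightarrow> real" where
  "moment \<mu> \<alpha> = (\<integral>x. monomial_at \<alpha> x \<partial>\<mu>)"

text \<open>
  A square matrix with rows and columns indexed by a finite set \<open>I\<close> is a function of two
  arguments, of which only the values on \<open>I\<close> matter.
\<close>

definition psd_on :: "'a set \<Rightarrow> ('a \<Rightarrow> 'a \<Rightarrow> real) \<Rightarrow> bool" where
  "psd_on I A \<longleftrightarrow>
     (\<forall>\<alpha>\<in>I. \<forall>\<beta>\<in>I. A \<alpha> \<beta> = A \<beta> \<alpha>) \<and>
     (\<forall>v :: 'a \<Rightarrow> real. 0 \<le> (\<Sum>\<alpha>\<in>I. \<Sum>\<beta>\<in>I. v \<alpha> * A \<alpha> \<beta> * v \<beta>))"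

definition loewner_le_on :: "'a set \<Rightarrow> ('a \<Rightarrow> 'a \<Rightarrow> real) \<Rightarrow> ('a \<Rightarrow> 'a \<Rightarrow> real) \<Rightarrow> bool" where
  "loewner_le_on I A B \<longleftrightarrow> psd_on I (\<lambda>\<alpha> \<beta>. B \<alpha> \<beta> - A \<alpha> \<beta>)"

definition moment_matrix ::
    "(('n::finite) multi_index \<Rightarrow> real) \<Rightarrow> 'n multi_index \<Rightarrow> 'n multi_index \<Rightarrow> real" where
  "moment_matrix \<phi> \<alpha> \<beta> = \<phi> (\<alpha> + \<beta>)"

text \<open>
  The vectors \<open>\<phi>\<close> and \<open>\<psi>\<close> are indexed by \<open>multi_indices (2 * n)\<close>; their values outside
  this set enter neither the constraints nor the objective.
\<close>

definition primal_feasible ::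
    "(real ^ 'n) measure \<Rightarrow> (real ^ 'n) measure \<Rightarrow> nat \<Rightarrow>
     (('n::finite) multi_index \<Rightarrow> real) \<Rightarrow> ('n multi_index \<Rightarrow> real) \<Rightarrow> bool" where
  "primal_feasible \<mu> \<nu> n \<phi> \<psi> \<longleftrightarrow>
     (\<forall>\<alpha>\<in>multi_indices (2 * n). \<phi> \<alpha> - \<psi> \<alpha> = moment \<mu> \<alpha> - moment \<nu> \<alpha>) \<and>
     psd_on (multi_indices n) (moment_matrix \<phi>) \<and>
     loewner_le_on (multi_indices n) (moment_matrix \<phi>) (moment_matrix (moment \<mu>)) \<and>
     psd_on (multi_indices n) (moment_matrix \<psi>) \<and>
     loewner_le_on (multi_indices n) (moment_matrix \<psi>) (moment_matrix (moment \<nu>))"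

definition primal_objective :: "(('n::finite) multi_index \<Rightarrow> real) \<Rightarrow> ('n multi_index \<Rightarrow> real) \<Rightarrow> real" where
  "primal_objective \<phi> \<psi> = \<phi> 0 + \<psi> 0"

definition dual_feasible ::
    "nat \<Rightarrow> ('n::finite) rpoly \<Rightarrow> 'n rpoly \<Rightarrow> 'n rpoly \<Rightarrow> 'n rpoly \<Rightarrow> 'n rpoly \<Rightarrow> bool" where
  "dual_feasible n p \<sigma>0 \<sigma>1 \<psi>0 \<psi>1 \<longleftrightarrow>
     1 - p = \<sigma>0 - \<sigma>1 \<and> 1 + p = \<psi>0 - \<psi>1 \<and>
     p \<in> polys_deg_le (2 * n) \<and>
     \<sigma>0 \<in> sos_polys n \<and> \<sigma>1 \<in> sos_polys n \<and> \<psi>0 \<in> sos_polys n \<and> \<psi>1 \<in> sos_polys n"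

text \<open>The integral against the signed measure \<open>\<mu> - \<nu>\<close> is the difference of the two integrals.\<close>

definition dual_objective ::
    "(real ^ 'n) measure \<Rightarrow> (real ^ 'n) measure \<Rightarrow> ('n::finite) rpoly \<Rightarrow> 'n rpoly \<Rightarrow> 'n rpoly \<Rightarrow> real" where
  "dual_objective \<mu> \<nu> p \<sigma>1 \<psi>1 =
     ((\<integral>x. poly_at p x \<partial>\<mu>) - (\<integral>x. poly_at p x \<partial>\<nu>))
     - (\<integral>x. poly_at \<sigma>1 x \<partial>\<mu>) - (\<integral>x. poly_at \<psi>1 x \<partial>\<nu>)"

text \<open>
  The optimal values are taken in the extended reals, where infimum and supremum carry no
  nonemptiness or boundedness side conditions.
\<close>

definition primal_value :: "(real ^ 'n) measure \<Rightarrow> (real ^ ('n::finite)) measure \<Rightarrow> nat \<Rightarrow> ereal" where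
  "primal_value \<mu> \<nu> n =
     Inf {ereal (primal_objective \<phi> \<psi>) | \<phi> \<psi>. primal_feasible \<mu> \<nu> n \<phi> \<psi>}"

definition dual_value :: "(real ^ 'n) measure \<Rightarrow> (real ^ ('n::finite)) measure \<Rightarrow> nat \<Rightarrow> ereal" where
  "dual_value \<mu> \<nu> n =
     Sup {ereal (dual_objective \<mu> \<nu> p \<sigma>1 \<psi>1) | p \<sigma>0 \<sigma>1 \<psi>0 \<psi>1. dual_feasible n p \<sigma>0 \<sigma>1 \<psi>0 \<psi>1}"

end

theory Submission
  imports Defs
begin

text \<open>Write L_\<phi> for \<open>riesz \<phi>\<close>, the linear functional sending the
  monomial of exponent \<alpha> to \<open>\<phi> \<alpha>\<close>. Apply L_\<phi> to 1 - p =
  \<sigma>0 - \<sigma>1 and L_\<psi> to 1 + p = \<psi>0 - \<psi>1 and add: the primal objective is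
  L_\<phi> p - L_\<psi> p + L_\<phi> \<sigma>0 - L_\<phi> \<sigma>1 + L_\<psi> \<psi>0 - L_\<psi>
  \<psi>1. By the equality constraints, the first difference is the integral of p against \<mu> -
  \<nu>. Positivity of the moment matrices lets the \<sigma>0 and \<psi>0 terms be dropped, and the
  Loewner bounds replace L_\<phi> \<sigma>1 and L_\<psi> \<psi>1 by the larger integrals against
  \<mu> and \<nu>. This is \<open>weak_duality\<close>.

  Positivity on sums of squares (\<open>riesz_sos_nonneg\<close>) requires each squared q to have
  degree at most n, so that L(q^2) is a value of the quadratic form of the n-th moment matrix. Only
  the sum is bounded in degree, but top-degree terms of squares cannot all cancel
  (\<open>sum_of_squares_degree\<close>).

  That the infimum is a minimum (\<open>primal_attained\<close>) is compactness: the Loewner bounds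
  confine the relevant entries, and the moments of \<mu> and \<nu> are a feasible point.\<close>

section \<open>Riesz functionals and coefficients of products\<close>

definition riesz :: "('a \<Rightarrow> real) \<Rightarrow> ('a \<Rightarrow>\<^sub>0 real) \<Rightarrow> real" where
  "riesz \<phi> p = (\<Sum>\<alpha>\<in>Poly_Mapping.keys p. Poly_Mapping.lookup p \<alpha> * \<phi> \<alpha>)"

text \<open>Extra indices contribute zero terms; a common index set is needed because
  \<open>p + q\<close> may lose keys by cancellation.\<close>

lemma riesz_superset:
  assumes "finite S" "Poly_Mapping.keys p \<subseteq> S"
  shows "riesz \<phi> p = (\<Sum>\<alpha>\<in>S. Poly_Mapping.lookup p \<alpha> * \<phi> \<alpha>)"
  unfolding riesz_def
  by (rule sum.mono_neutral_left) (use assms in \<open>auto simp: in_keys_iff\<close>)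

lemma riesz_add: "riesz \<phi> (p + q) = riesz \<phi> p + riesz \<phi> q"
proof -
  let ?S = "Poly_Mapping.keys p \<union> Poly_Mapping.keys q"
  have "Poly_Mapping.keys (p + q) \<subseteq> ?S" by (rule Poly_Mapping.keys_add)
  then show ?thesis
    by (simp add: riesz_superset[of ?S] lookup_add distrib_right sum.distrib)
qed

lemma riesz_uminus: "riesz \<phi> (- p) = - riesz \<phi> p"
  by (simp add: riesz_def sum_negf)

lemma riesz_diff: "riesz \<phi> (p - q) = riesz \<phi> p - riesz \<phi> q"
  using riesz_add[of \<phi> p "- q"] by (simp add: riesz_uminus)

lemma riesz_zero [simp]: "riesz \<phi> 0 = 0"
  by (simp add: riesz_def)

lemma riesz_single [simp]: "riesz \<phi> (Poly_Mapping.single \<alpha> a) = a * \<phi> \<alpha>"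
  by (simp add: riesz_def)

lemma riesz_one [simp]: "riesz \<phi> 1 = \<phi> 0"
  by (simp add: riesz_def)

lemma riesz_sum: "riesz \<phi> (sum f A) = (\<Sum>x\<in>A. riesz \<phi> (f x))"
  by (induction A rule: infinite_finite_induct) (auto simp: riesz_add)

lemma riesz_sum_list: "riesz \<phi> (\<Sum>x\<leftarrow>xs. f x) = (\<Sum>x\<leftarrow>xs. riesz \<phi> (f x))"
  by (induction xs) (auto simp: riesz_add)

lemma riesz_minus_functional: "riesz (\<lambda>\<alpha>. \<phi> \<alpha> - \<psi> \<alpha>) p = riesz \<phi> p - riesz \<psi> p"
  by (simp add: riesz_def right_diff_distrib sum_subtractf)

lemma poly_mapping_eq_sum_single:
  assumes "finite S" "Poly_Mapping.keys p \<subseteq> S"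
  shows "p = (\<Sum>\<alpha>\<in>S. Poly_Mapping.single \<alpha> (Poly_Mapping.lookup p \<alpha>))"
proof (rule poly_mapping_eqI)
  fix k
  show "Poly_Mapping.lookup p k =
      Poly_Mapping.lookup (\<Sum>\<alpha>\<in>S. Poly_Mapping.single \<alpha> (Poly_Mapping.lookup p \<alpha>)) k"
    using assms by (auto simp: lookup_sum lookup_single when_def in_keys_iff)
qed

lemma riesz_mult:
  fixes p q :: "'a::comm_monoid_add \<Rightarrow>\<^sub>0 real"
  assumes "finite S" "Poly_Mapping.keys p \<subseteq> S" "finite T" "Poly_Mapping.keys q \<subseteq> T"
  shows "riesz \<phi> (p * q) = (\<Sum>\<beta>\<in>S. \<Sum>\<gamma>\<in>T.
    Poly_Mapping.lookup p \<beta> * Poly_Mapping.lookup q \<gamma> * \<phi> (\<beta> + \<gamma>))"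
proof -
  have "p * q = (\<Sum>\<beta>\<in>S. Poly_Mapping.single \<beta> (Poly_Mapping.lookup p \<beta>)) *
      (\<Sum>\<gamma>\<in>T. Poly_Mapping.single \<gamma> (Poly_Mapping.lookup q \<gamma>))"
    using poly_mapping_eq_sum_single[OF assms(1,2)] poly_mapping_eq_sum_single[OF assms(3,4)]
    by argo
  then show ?thesis
    by (simp add: sum_product mult_single riesz_sum)
qed

text \<open>The value is the quadratic form of the matrix at the coefficient vector of
  \<open>q\<close>.\<close>

lemma riesz_square_nonneg:
  fixes q :: "'a::comm_monoid_add \<Rightarrow>\<^sub>0 real"
  assumes "finite I" "psd_on I (\<lambda>\<alpha> \<beta>. \<phi> (\<alpha> + \<beta>))" "Poly_Mapping.keys q \<subseteq> I"
  shows "0 \<le> riesz \<phi> (q ^ 2)"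
proof -
  have "riesz \<phi> (q ^ 2) = (\<Sum>\<beta>\<in>I. \<Sum>\<gamma>\<in>I.
      Poly_Mapping.lookup q \<beta> * \<phi> (\<beta> + \<gamma>) * Poly_Mapping.lookup q \<gamma>)"
    unfolding power2_eq_square riesz_mult[OF assms(1,3,1,3)]
    by (simp add: mult_ac)
  then show ?thesis
    using assms(2) by (simp add: psd_on_def)
qed

text \<open>Coefficient extraction is the Riesz functional of an indicator, so it inherits linearity
  and the product formula.\<close>

lemma lookup_eq_riesz: "Poly_Mapping.lookup p \<alpha> = riesz (\<lambda>\<beta>. of_bool (\<beta> = \<alpha>)) p"
proof -
  have "riesz (\<lambda>\<beta>. of_bool (\<beta> = \<alpha>)) p =
      (\<Sum>\<beta>\<in>insert \<alpha> (Poly_Mapping.keys p). Poly_Mapping.lookup p \<beta> * of_bool (\<beta> = \<alpha>))"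
    by (rule riesz_superset) auto
  also have "\<dots> = (\<Sum>\<beta>\<in>insert \<alpha> (Poly_Mapping.keys p). if \<beta> = \<alpha> then Poly_Mapping.lookup p \<alpha> else 0)"
    by (rule sum.cong) auto
  also have "\<dots> = Poly_Mapping.lookup p \<alpha>"
    by (subst sum.delta) auto
  finally show ?thesis ..
qed

text \<open>In the double sum for this coefficient, the hypothesis leaves only the pair (\<alpha>,
  \<alpha>).\<close>

lemma lookup_square_double:
  fixes q :: "'a::comm_monoid_add \<Rightarrow>\<^sub>0 real"
  assumes "\<And>\<beta> \<gamma>. \<beta> \<in> Poly_Mapping.keys q \<Longrightarrow> \<gamma> \<in> Poly_Mapping.keys q \<Longrightarrow>
    \<beta> + \<gamma> = \<alpha> + \<alpha> \<Longrightarrow> \<beta> = \<alpha> \<and> \<gamma> = \<alpha>"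
  shows "Poly_Mapping.lookup (q ^ 2) (\<alpha> + \<alpha>) = (Poly_Mapping.lookup q \<alpha>)\<^sup>2"
proof -
  let ?S = "insert \<alpha> (Poly_Mapping.keys q)"
  have "Poly_Mapping.lookup (q ^ 2) (\<alpha> + \<alpha>) = (\<Sum>\<beta>\<in>?S. \<Sum>\<gamma>\<in>?S.
      Poly_Mapping.lookup q \<beta> * Poly_Mapping.lookup q \<gamma> * of_bool (\<beta> + \<gamma> = \<alpha> + \<alpha>))"
    unfolding lookup_eq_riesz[of "q ^ 2"] unfolding power2_eq_square by (rule riesz_mult) auto
  also have "\<dots> = (\<Sum>\<beta>\<in>?S. \<Sum>\<gamma>\<in>?S.
      if \<beta> = \<alpha> then if \<gamma> = \<alpha> then (Poly_Mapping.lookup q \<alpha>)\<^sup>2 else 0 else 0)"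
  proof (intro sum.cong refl)
    fix \<beta> \<gamma>
    show "Poly_Mapping.lookup q \<beta> * Poly_Mapping.lookup q \<gamma> * of_bool (\<beta> + \<gamma> = \<alpha> + \<alpha>) =
        (if \<beta> = \<alpha> then if \<gamma> = \<alpha> then (Poly_Mapping.lookup q \<alpha>)\<^sup>2 else 0 else 0)"
    proof (cases "\<beta> = \<alpha> \<and> \<gamma> = \<alpha>")
      case True
      then show ?thesis by (simp add: power2_eq_square)
    next
      case False
      then have "\<beta> \<in> Poly_Mapping.keys q \<Longrightarrow> \<gamma> \<in> Poly_Mapping.keys q \<Longrightarrow> \<beta> + \<gamma> \<noteq> \<alpha> + \<alpha>"
        using assms by blast
      then show ?thesis
        using False by (auto simp: in_keys_iff)
    qed
  qed
  also have "\<dots> = (\<Sum>\<beta>\<in>?S. if \<beta> = \<alpha> then (Poly_Mapping.lookup q \<alpha>)\<^sup>2 else 0)"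
    by (intro sum.cong refl) (simp add: sum.delta del: sum.insert sum.insert_if)
  also have "\<dots> = (Poly_Mapping.lookup q \<alpha>)\<^sup>2"
    by (subst sum.delta) auto
  finally show ?thesis .
qed

section \<open>Multi-indices of bounded degree\<close>

lemma multi_indices_add:
  assumes "\<alpha> \<in> multi_indices m" "\<beta> \<in> multi_indices n"
  shows "\<alpha> + \<beta> \<in> multi_indices (m + n)"
  using assms by (simp add: multi_indices_def lookup_add sum.distrib)

lemma finite_multi_indices [simp]: "finite (multi_indices n :: 'n::finite multi_index set)"
proof (rule finite_imageD)
  have "Poly_Mapping.lookup ` (multi_indices n :: 'n multi_index set) \<subseteq> PiE UNIV (\<lambda>_. {..n})"
  proof (intro image_subsetI PiE_I)
    fix \<alpha> :: "'n multi_index" and i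
    assume "\<alpha> \<in> multi_indices n"
    moreover have "Poly_Mapping.lookup \<alpha> i \<le> (\<Sum>i\<in>UNIV. Poly_Mapping.lookup \<alpha> i)"
      by (rule member_le_sum) auto
    ultimately show "Poly_Mapping.lookup \<alpha> i \<in> {..n}"
      by (simp add: multi_indices_def)
  qed simp
  then show "finite (Poly_Mapping.lookup ` (multi_indices n :: 'n multi_index set))"
    by (rule finite_subset) (auto intro: finite_PiE)
  show "inj_on Poly_Mapping.lookup (multi_indices n :: 'n multi_index set)"
    by (auto intro: inj_onI poly_mapping_eqI)
qed

text \<open>For m = n, every moment of degree at most 2n is thus an entry of the n-th moment matrix.
  The induction moves exponent units one at a time into the first summand.\<close>

lemma multi_indices_split:
  assumes "\<alpha> \<in> multi_indices (m + n)"
  obtains \<beta> \<gamma> where "\<alpha> = \<beta> + \<gamma>" "\<beta> \<in> multi_indices m" "\<gamma> \<in> multi_indices n"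
proof -
  have "\<exists>\<beta> \<gamma>. \<alpha> = \<beta> + \<gamma> \<and> \<beta> \<in> multi_indices m \<and> \<gamma> \<in> multi_indices n"
    using assms
  proof (induction m arbitrary: \<alpha>)
    case 0
    then show ?case
      by (intro exI[of _ 0] exI[of _ \<alpha>]) (simp add: multi_indices_def)
  next
    case (Suc m)
    show ?case
    proof (cases "\<alpha> = 0")
      case True
      then show ?thesis
        by (intro exI[of _ 0]) (simp add: multi_indices_def)
    next
      case False
      then obtain i where i: "Poly_Mapping.lookup \<alpha> i \<noteq> 0"
        by (metis lookup_zero poly_mapping_eqI)
      \<comment> \<open>\<open>e\<close> is one unit of a variable occurring in \<alpha>, so the
        truncated subtraction of \<open>e\<close> is undone by adding it back.\<close>
      define e where "e = Poly_Mapping.single i (1::nat)"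
      have eq: "\<alpha> = (\<alpha> - e) + e"
        using i by (intro poly_mapping_eqI)
          (auto simp: e_def lookup_add lookup_minus lookup_single when_def)
      have deg_e: "(\<Sum>j\<in>UNIV. Poly_Mapping.lookup e j) = 1"
        by (simp add: e_def lookup_single when_def)
      have "(\<Sum>j\<in>UNIV. Poly_Mapping.lookup \<alpha> j) =
          (\<Sum>j\<in>UNIV. Poly_Mapping.lookup (\<alpha> - e) j) + 1"
        unfolding deg_e[symmetric] sum.distrib[symmetric] lookup_add[symmetric] eq[symmetric] ..
      with Suc.prems have "\<alpha> - e \<in> multi_indices (m + n)"
        by (simp add: multi_indices_def)
      then obtain \<beta> \<gamma> where *: "\<alpha> - e = \<beta> + \<gamma>" "\<beta> \<in> multi_indices m" "\<gamma> \<in> multi_indices n"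
        using Suc.IH by blast
      have "\<beta> + e \<in> multi_indices (Suc m)"
        using *(2) deg_e by (simp add: multi_indices_def lookup_add sum.distrib)
      moreover have "\<alpha> = (\<beta> + e) + \<gamma>"
        using eq *(1) by (simp add: add_ac)
      ultimately show ?thesis
        using *(3) by blast
    qed
  qed
  then show thesis using that by blast
qed

section \<open>Sums of squares\<close>

text \<open>
  If some square had too large a degree, choose among the exponents of maximal degree occurring in
  the squared polynomials one, \<open>\<alpha>\<close>, of maximal Euclidean norm. By strict convexity of the norm, the
  only way to write \<open>2\<alpha>\<close> as a sum of two occurring exponents is \<open>\<alpha> + \<alpha>\<close>, so the coefficient of
  \<open>2\<alpha>\<close> in the sum is a sum of squares, not all zero.
\<close>

lemma sum_of_squares_degree:
  fixes qs :: "'n::finite rpoly list"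
  assumes "(\<Sum>q\<leftarrow>qs. q ^ 2) \<in> polys_deg_le (2 * n)" "q \<in> set qs"
  shows "q \<in> polys_deg_le n"
proof (rule ccontr)
  assume neg: "q \<notin> polys_deg_le n"
  define U where "U = (\<Union>q\<in>set qs. Poly_Mapping.keys q)"
  define deg :: "'n multi_index \<Rightarrow> nat" where "deg = (\<lambda>\<alpha>. \<Sum>i\<in>UNIV. Poly_Mapping.lookup \<alpha> i)"
  define nrm :: "'n multi_index \<Rightarrow> nat"
    where "nrm = (\<lambda>\<alpha>. \<Sum>i\<in>UNIV. (Poly_Mapping.lookup \<alpha> i)\<^sup>2)"
  obtain \<alpha>0 where \<alpha>0: "\<alpha>0 \<in> U" "n < deg \<alpha>0"
    using neg assms(2) unfolding polys_deg_le_def U_def multi_indices_def deg_def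
    by (auto simp: not_le subset_iff)
  have fin: "finite U" by (auto simp: U_def)
  define m where "m = Max (deg ` U)"
  have m_ge: "deg \<beta> \<le> m" if "\<beta> \<in> U" for \<beta>
    using that fin by (simp add: m_def)
  define V where "V = {\<beta>\<in>U. deg \<beta> = m}"
  have "m \<in> deg ` U"
    unfolding m_def using fin \<alpha>0 by (intro Max_in) auto
  then have "V \<noteq> {}" "finite V"
    using fin by (auto simp: V_def)
  then have "Max (nrm ` V) \<in> nrm ` V" by (intro Max_in) auto
  then obtain \<alpha> where \<alpha>: "\<alpha> \<in> V" "nrm \<alpha> = Max (nrm ` V)" by auto
  have nrm_le: "nrm \<beta> \<le> nrm \<alpha>" if "\<beta> \<in> V" for \<beta>
    using that \<open>finite V\<close> \<alpha>(2) by simp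
  have extreme: "\<beta> = \<alpha> \<and> \<gamma> = \<alpha>" if "\<beta> \<in> U" "\<gamma> \<in> U" "\<beta> + \<gamma> = \<alpha> + \<alpha>" for \<beta> \<gamma>
  proof -
    have lk: "Poly_Mapping.lookup \<beta> i + Poly_Mapping.lookup \<gamma> i = 2 * Poly_Mapping.lookup \<alpha> i" for i
      using arg_cong[OF that(3), of "\<lambda>\<delta>. Poly_Mapping.lookup \<delta> i"] by (simp add: lookup_add)
    have "deg \<beta> + deg \<gamma> = 2 * deg \<alpha>"
      by (simp add: deg_def sum.distrib[symmetric] lk sum_distrib_left)
    \<comment> \<open>Both degrees are at most \<open>m\<close> and they add up to 2m, so both equal
      \<open>m\<close>.\<close>
    then have "\<beta> \<in> V" "\<gamma> \<in> V"
      using m_ge[OF that(1)] m_ge[OF that(2)] \<alpha>(1) that by (auto simp: V_def)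
    \<comment> \<open>Parallelogram law with \<beta> + \<gamma> = 2\<alpha>; maximality of
      \<open>nrm \<alpha>\<close> then makes the right-hand side nonpositive.\<close>
    have "(\<Sum>i\<in>UNIV. (real (Poly_Mapping.lookup \<beta> i) - real (Poly_Mapping.lookup \<gamma> i))\<^sup>2) =
        (\<Sum>i\<in>UNIV. 2 * (real (Poly_Mapping.lookup \<beta> i))\<^sup>2 + 2 * (real (Poly_Mapping.lookup \<gamma> i))\<^sup>2
          - 4 * (real (Poly_Mapping.lookup \<alpha> i))\<^sup>2)"
    proof (rule sum.cong[OF refl])
      fix i
      have e: "real (Poly_Mapping.lookup \<alpha> i) =
          (real (Poly_Mapping.lookup \<beta> i) + real (Poly_Mapping.lookup \<gamma> i)) / 2"
        using arg_cong[OF lk[of i], of real] by simp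
      show "(real (Poly_Mapping.lookup \<beta> i) - real (Poly_Mapping.lookup \<gamma> i))\<^sup>2 =
          2 * (real (Poly_Mapping.lookup \<beta> i))\<^sup>2 + 2 * (real (Poly_Mapping.lookup \<gamma> i))\<^sup>2
          - 4 * (real (Poly_Mapping.lookup \<alpha> i))\<^sup>2"
        unfolding e by (simp add: power2_eq_square field_simps)
    qed
    also have "\<dots> = 2 * real (nrm \<beta>) + 2 * real (nrm \<gamma>) - 4 * real (nrm \<alpha>)"
      by (simp add: nrm_def sum.distrib sum_subtractf sum_distrib_left)
    also have "\<dots> \<le> 0"
      using nrm_le[OF \<open>\<beta> \<in> V\<close>] nrm_le[OF \<open>\<gamma> \<in> V\<close>] by simp
    finally have le0: "(\<Sum>i\<in>UNIV. (real (Poly_Mapping.lookup \<beta> i) - real (Poly_Mapping.lookup \<gamma> i))\<^sup>2) \<le> 0" .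
    have "(\<Sum>i\<in>UNIV. (real (Poly_Mapping.lookup \<beta> i) - real (Poly_Mapping.lookup \<gamma> i))\<^sup>2) = 0"
      by (rule antisym[OF le0]) (simp add: sum_nonneg)
    then have eq: "Poly_Mapping.lookup \<beta> i = Poly_Mapping.lookup \<gamma> i" for i
      by (simp add: sum_nonneg_eq_0_iff)
    then have "Poly_Mapping.lookup \<beta> i = Poly_Mapping.lookup \<alpha> i" for i
      using lk[of i] by simp
    with eq show ?thesis by (simp add: poly_mapping_eq_iff fun_eq_iff)
  qed
  have "Poly_Mapping.lookup (\<Sum>q\<leftarrow>qs. q ^ 2) (\<alpha> + \<alpha>) =
      (\<Sum>q\<leftarrow>qs. Poly_Mapping.lookup (q ^ 2) (\<alpha> + \<alpha>))"
    unfolding lookup_eq_riesz by (rule riesz_sum_list)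
  also have "\<dots> = (\<Sum>q\<leftarrow>qs. (Poly_Mapping.lookup q \<alpha>)\<^sup>2)"
    by (intro arg_cong[where f = sum_list] map_cong refl lookup_square_double extreme)
      (auto simp: U_def)
  finally have coeff: "Poly_Mapping.lookup (\<Sum>q\<leftarrow>qs. q ^ 2) (\<alpha> + \<alpha>) =
      (\<Sum>q\<leftarrow>qs. (Poly_Mapping.lookup q \<alpha>)\<^sup>2)" .
  obtain r where r: "r \<in> set qs" "Poly_Mapping.lookup r \<alpha> \<noteq> 0"
    using \<alpha>(1) by (auto simp: V_def U_def in_keys_iff)
  have "(Poly_Mapping.lookup r \<alpha>)\<^sup>2 \<le> (\<Sum>q\<leftarrow>qs. (Poly_Mapping.lookup q \<alpha>)\<^sup>2)"
    using r by (intro member_le_sum_list) auto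
  with r have "Poly_Mapping.lookup (\<Sum>q\<leftarrow>qs. q ^ 2) (\<alpha> + \<alpha>) \<noteq> 0"
    unfolding coeff by (smt (verit) zero_less_power2)
  then have "\<alpha> + \<alpha> \<in> multi_indices (2 * n)"
    using assms(1) by (auto simp: polys_deg_le_def in_keys_iff)
  moreover have "deg \<alpha> > n"
    using \<alpha>(1) m_ge[OF \<alpha>0(1)] \<alpha>0(2) by (simp add: V_def)
  ultimately show False
    by (simp add: multi_indices_def deg_def lookup_add sum.distrib)
qed

lemma riesz_sos_nonneg:
  assumes "psd_on (multi_indices n) (moment_matrix \<phi>)" "\<sigma> \<in> sos_polys n"
  shows "0 \<le> riesz \<phi> \<sigma>"
proof -
  obtain qs where qs: "\<sigma> = (\<Sum>q\<leftarrow>qs. q ^ 2)" and deg: "\<sigma> \<in> polys_deg_le (2 * n)"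
    using assms(2) by (auto simp: sos_polys_def)
  have "0 \<le> riesz \<phi> (q ^ 2)" if "q \<in> set qs" for q
  proof (rule riesz_square_nonneg)
    show "psd_on (multi_indices n) (\<lambda>\<alpha> \<beta>. \<phi> (\<alpha> + \<beta>))"
      using assms(1) by (simp add: moment_matrix_def[abs_def])
    show "Poly_Mapping.keys q \<subseteq> multi_indices n"
      using sum_of_squares_degree[of qs n q] deg qs that by (simp add: polys_deg_le_def)
  qed simp
  then show ?thesis
    unfolding qs riesz_sum_list by (intro sum_list_nonneg) auto
qed

section \<open>Weak duality\<close>

text \<open>Moment matrices are linear in the sequence, so \<open>riesz_sos_nonneg\<close> also
  applies to Loewner bounds.\<close>

lemma loewner_le_on_moment_matrix:
  "loewner_le_on I (moment_matrix \<phi>) (moment_matrix \<psi>) \<longleftrightarrow>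
    psd_on I (moment_matrix (\<lambda>\<alpha>. \<psi> \<alpha> - \<phi> \<alpha>))"
  by (simp add: loewner_le_on_def moment_matrix_def[abs_def])

lemma integral_poly_at:
  assumes "\<And>\<alpha>. integrable \<mu> (monomial_at \<alpha>)"
  shows "(\<integral>x. poly_at p x \<partial>\<mu>) = riesz (moment \<mu>) p"
  using assms by (simp add: poly_at_def riesz_def moment_def)

lemma weak_duality:
  assumes \<mu>: "\<And>\<alpha>. integrable \<mu> (monomial_at \<alpha>)" and \<nu>: "\<And>\<alpha>. integrable \<nu> (monomial_at \<alpha>)"
    and P: "primal_feasible \<mu> \<nu> n \<phi> \<psi>" and D: "dual_feasible n p \<sigma>0 \<sigma>1 \<psi>0 \<psi>1"
  shows "dual_objective \<mu> \<nu> p \<sigma>1 \<psi>1 \<le> primal_objective \<phi> \<psi>"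
proof -
  \<comment> \<open>The equality constraints reach only degree 2n, which covers all keys of
    \<open>p\<close>.\<close>
  have "riesz (moment \<mu>) p - riesz (moment \<nu>) p = riesz \<phi> p - riesz \<psi> p"
    unfolding riesz_minus_functional[symmetric] unfolding riesz_def
    using P D by (intro sum.cong) (auto simp: primal_feasible_def dual_feasible_def polys_deg_le_def)
  moreover have "riesz \<phi> (1 - p) = riesz \<phi> (\<sigma>0 - \<sigma>1)" "riesz \<psi> (1 + p) = riesz \<psi> (\<psi>0 - \<psi>1)"
    using D by (simp_all add: dual_feasible_def)
  moreover have "0 \<le> riesz \<phi> \<sigma>0" "0 \<le> riesz \<psi> \<psi>0"
    "0 \<le> riesz (\<lambda>\<alpha>. moment \<mu> \<alpha> - \<phi> \<alpha>) \<sigma>1" "0 \<le> riesz (\<lambda>\<alpha>. moment \<nu> \<alpha> - \<psi> \<alpha>) \<psi>1"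
    using P D by (auto simp: primal_feasible_def dual_feasible_def loewner_le_on_moment_matrix
        intro: riesz_sos_nonneg)
  ultimately show ?thesis
    by (simp add: dual_objective_def primal_objective_def integral_poly_at[OF \<mu>]
        integral_poly_at[OF \<nu>] riesz_minus_functional riesz_add riesz_diff)
qed

section \<open>Positive semidefinite matrices: moments, entry bounds, topology\<close>

lemma monomial_at_add: "monomial_at (\<alpha> + \<beta>) x = monomial_at \<alpha> x * monomial_at \<beta> x"
  by (simp add: monomial_at_def lookup_add power_add prod.distrib)

text \<open>The quadratic form at v is the integral of the square of the polynomial with
  coefficients v.\<close>

lemma psd_on_moment_matrix_moment:
  assumes "\<And>\<alpha>. integrable \<mu> (monomial_at \<alpha>)"
  shows "psd_on I (moment_matrix (moment \<mu>))"
proof -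
  have "0 \<le> (\<Sum>\<alpha>\<in>I. \<Sum>\<beta>\<in>I. v \<alpha> * moment \<mu> (\<alpha> + \<beta>) * v \<beta>)" for v
  proof -
    have "(\<Sum>\<alpha>\<in>I. \<Sum>\<beta>\<in>I. v \<alpha> * moment \<mu> (\<alpha> + \<beta>) * v \<beta>) =
        (\<integral>x. (\<Sum>\<alpha>\<in>I. \<Sum>\<beta>\<in>I. v \<alpha> * monomial_at (\<alpha> + \<beta>) x * v \<beta>) \<partial>\<mu>)"
      using assms by (simp add: moment_def)
    also have "\<dots> = (\<integral>x. (\<Sum>\<alpha>\<in>I. v \<alpha> * monomial_at \<alpha> x)\<^sup>2 \<partial>\<mu>)"
      by (simp add: monomial_at_add power2_eq_square sum_product mult_ac)
    also have "\<dots> \<ge> 0" by (rule integral_nonneg_AE) simp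
    finally show ?thesis .
  qed
  then show ?thesis
    by (simp add: psd_on_def moment_matrix_def add.commute)
qed

text \<open>Evaluate the form at e_a + s e_b for s = 1 and s = -1.\<close>

lemma psd_on_entry_bound:
  assumes "psd_on I A" "finite I" "a \<in> I" "b \<in> I"
  shows "2 * \<bar>A a b\<bar> \<le> A a a + A b b"
proof -
  have "0 \<le> A a a + 2 * s * A a b + s * s * A b b" for s
  proof -
    \<comment> \<open>Adding two indicators, rather than distinguishing cases, also covers
      \<open>a = b\<close>.\<close>
    let ?v = "\<lambda>x. (if x = a then 1 else 0) + s * (if x = b then 1 else 0)"
    have "0 \<le> (\<Sum>\<alpha>\<in>I. \<Sum>\<beta>\<in>I. ?v \<alpha> * A \<alpha> \<beta> * ?v \<beta>)"
      by (rule assms(1)[unfolded psd_on_def, THEN conjunct2, rule_format])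
    also have "\<dots> = (\<Sum>\<alpha>\<in>I. ?v \<alpha> * (A \<alpha> a + s * A \<alpha> b))"
    proof (rule sum.cong[OF refl])
      fix \<alpha>
      have "(\<Sum>\<beta>\<in>I. ?v \<alpha> * A \<alpha> \<beta> * ?v \<beta>) =
          (\<Sum>\<beta>\<in>I. (if \<beta> = a then ?v \<alpha> * A \<alpha> a else 0) + (if \<beta> = b then s * ?v \<alpha> * A \<alpha> b else 0))"
        by (intro sum.cong) (auto simp: algebra_simps)
      also have "\<dots> = ?v \<alpha> * (A \<alpha> a + s * A \<alpha> b)"
        using assms by (simp add: sum.distrib algebra_simps)
      finally show "(\<Sum>\<beta>\<in>I. ?v \<alpha> * A \<alpha> \<beta> * ?v \<beta>) = ?v \<alpha> * (A \<alpha> a + s * A \<alpha> b)" .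
    qed
    also have "\<dots> = (\<Sum>\<alpha>\<in>I. (if \<alpha> = a then A a a + s * A a b else 0) +
        (if \<alpha> = b then s * (A b a + s * A b b) else 0))"
      by (intro sum.cong) (auto simp: algebra_simps)
    also have "\<dots> = A a a + s * A a b + s * (A b a + s * A b b)"
      using assms by (simp add: sum.distrib)
    also have "A b a = A a b"
      using assms by (auto simp: psd_on_def)
    finally show ?thesis by (simp add: algebra_simps)
  qed
  from this[of 1] this[of "-1"] show ?thesis by simp
qed

lemma psd_on_diag_nonneg:
  assumes "psd_on I A" "finite I" "a \<in> I"
  shows "0 \<le> A a a"
  using psd_on_entry_bound[OF assms assms(3)] by simp

lemma closed_psd_on:
  assumes "\<And>\<alpha> \<beta>. continuous_on UNIV (\<lambda>x. A x \<alpha> \<beta>)"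
  shows "closed {x. psd_on I (A x)}"
  unfolding psd_on_def Ball_def
  by (intro closed_Collect_conj closed_Collect_all closed_Collect_imp closed_Collect_eq
      closed_Collect_le continuous_intros assms open_Collect_const)

text \<open>Tychonoff's theorem, as the topology on functions is the product topology.\<close>

lemma compact_PiE_UNIV:
  fixes K :: "'a \<Rightarrow> real set"
  assumes "\<And>i. compact (K i)"
  shows "compact (PiE UNIV K)"
  using assms compactin_PiE[of "\<lambda>_. euclidean" UNIV K]
  by (simp add: euclidean_product_topology)

section \<open>The primal feasible set and its minimizer\<close>

lemma psd_on_cong:
  assumes "\<And>\<alpha> \<beta>. \<alpha> \<in> I \<Longrightarrow> \<beta> \<in> I \<Longrightarrow> A \<alpha> \<beta> = B \<alpha> \<beta>"
  shows "psd_on I A \<longleftrightarrow> psd_on I B"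
  using assms by (simp add: psd_on_def)

lemma primal_feasible_cong:
  assumes "\<And>\<alpha>. \<alpha> \<in> multi_indices (2 * n) \<Longrightarrow> \<phi> \<alpha> = \<phi>' \<alpha>"
    and "\<And>\<alpha>. \<alpha> \<in> multi_indices (2 * n) \<Longrightarrow> \<psi> \<alpha> = \<psi>' \<alpha>"
  shows "primal_feasible \<mu> \<nu> n \<phi> \<psi> \<longleftrightarrow> primal_feasible \<mu> \<nu> n \<phi>' \<psi>'"
proof -
  have "\<alpha> + \<beta> \<in> multi_indices (2 * n)" if "\<alpha> \<in> multi_indices n" "\<beta> \<in> multi_indices n"
    for \<alpha> \<beta> :: "'a multi_index"
    using multi_indices_add[OF that] by (simp add: mult_2)
  then have "psd_on (multi_indices n) (moment_matrix \<phi>) = psd_on (multi_indices n) (moment_matrix \<phi>')"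
    "psd_on (multi_indices n) (moment_matrix \<psi>) = psd_on (multi_indices n) (moment_matrix \<psi>')"
    "psd_on (multi_indices n) (moment_matrix (\<lambda>\<alpha>. moment \<mu> \<alpha> - \<phi> \<alpha>)) =
      psd_on (multi_indices n) (moment_matrix (\<lambda>\<alpha>. moment \<mu> \<alpha> - \<phi>' \<alpha>))"
    "psd_on (multi_indices n) (moment_matrix (\<lambda>\<alpha>. moment \<nu> \<alpha> - \<psi> \<alpha>)) =
      psd_on (multi_indices n) (moment_matrix (\<lambda>\<alpha>. moment \<nu> \<alpha> - \<psi>' \<alpha>))"
    using assms by (intro psd_on_cong; simp add: moment_matrix_def)+
  then show ?thesis
    using assms by (simp add: primal_feasible_def loewner_le_on_moment_matrix)
qed

text \<open>The diagonal of the matrix of \<phi> dominates its entries and is itself dominated by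
  the diagonal of the matrix of \<mu>.\<close>

lemma primal_feasible_bound:
  assumes "primal_feasible \<mu> \<nu> n \<phi> \<psi>" "\<beta> \<in> multi_indices n" "\<gamma> \<in> multi_indices n"
  shows "2 * \<bar>\<phi> (\<beta> + \<gamma>)\<bar> \<le> moment \<mu> (\<beta> + \<beta>) + moment \<mu> (\<gamma> + \<gamma>)"
proof -
  have psd: "psd_on (multi_indices n) (moment_matrix \<phi>)"
    "psd_on (multi_indices n) (moment_matrix (\<lambda>\<alpha>. moment \<mu> \<alpha> - \<phi> \<alpha>))"
    using assms(1) by (auto simp: primal_feasible_def loewner_le_on_moment_matrix)
  have diag: "\<phi> (\<delta> + \<delta>) \<le> moment \<mu> (\<delta> + \<delta>)" if "\<delta> \<in> multi_indices n" for \<delta>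
    using psd_on_diag_nonneg[OF psd(2) finite_multi_indices that]
    by (simp add: moment_matrix_def)
  show ?thesis
    using order_trans[OF psd_on_entry_bound[OF psd(1) finite_multi_indices assms(2,3)]]
      add_mono[OF diag[OF assms(2)] diag[OF assms(3)]]
    unfolding moment_matrix_def by blast
qed

text \<open>
  The equality constraint determines \<open>\<psi>\<close> from \<open>\<phi>\<close>, and entries of a positive semidefinite matrix
  are bounded by its diagonal, hence here by moments of \<open>\<mu>\<close>. Setting the irrelevant entries of \<open>\<phi>\<close>
  to \<open>0\<close> makes the feasible set compact in the product topology.
\<close>

lemma primal_attained:
  fixes \<mu> \<nu> :: "(real ^ 'n::finite) measure"
  assumes \<mu>: "\<And>\<alpha>. integrable \<mu> (monomial_at \<alpha>)" and \<nu>: "\<And>\<alpha>. integrable \<nu> (monomial_at \<alpha>)"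
  obtains \<phi> \<psi> where "primal_feasible \<mu> \<nu> n \<phi> \<psi>"
    "\<And>\<phi>' \<psi>'. primal_feasible \<mu> \<nu> n \<phi>' \<psi>' \<Longrightarrow> primal_objective \<phi> \<psi> \<le> primal_objective \<phi>' \<psi>'"
proof -
  define d where "d = (\<lambda>\<alpha>. moment \<mu> \<alpha> - moment \<nu> \<alpha>)"
  define F where "F = {\<phi>. primal_feasible \<mu> \<nu> n \<phi> (\<lambda>\<alpha>. \<phi> \<alpha> - d \<alpha>)}"
  define trunc :: "('n multi_index \<Rightarrow> real) \<Rightarrow> 'n multi_index \<Rightarrow> real"
    where "trunc = (\<lambda>\<phi> \<alpha>. if \<alpha> \<in> multi_indices (2 * n) then \<phi> \<alpha> else 0)"
  \<comment> \<open>The bound concerns \<open>trunc \<phi>\<close> because members of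
    \<open>F\<close> are unrestricted beyond degree 2n.\<close>
  have "\<exists>b. \<forall>\<phi>\<in>F. \<bar>trunc \<phi> \<alpha>\<bar> \<le> b" for \<alpha>
  proof (cases "\<alpha> \<in> multi_indices (2 * n)")
    case True
    then obtain \<beta> \<gamma> where *: "\<alpha> = \<beta> + \<gamma>" "\<beta> \<in> multi_indices n" "\<gamma> \<in> multi_indices n"
      using multi_indices_split[of \<alpha> n n] by (auto simp: mult_2)
    have "\<bar>trunc \<phi> \<alpha>\<bar> \<le> (moment \<mu> (\<beta> + \<beta>) + moment \<mu> (\<gamma> + \<gamma>)) / 2" if "\<phi> \<in> F" for \<phi>
      using primal_feasible_bound[of \<mu> \<nu> n \<phi> "\<lambda>\<alpha>. \<phi> \<alpha> - d \<alpha>" \<beta> \<gamma>] that * True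
      by (simp add: F_def trunc_def)
    then show ?thesis by blast
  qed (auto simp: trunc_def)
  then obtain B where B: "\<And>\<phi> \<alpha>. \<phi> \<in> F \<Longrightarrow> \<bar>trunc \<phi> \<alpha>\<bar> \<le> B \<alpha>" by metis
  \<comment> \<open>\<open>K\<close> need not consist of truncated sequences; it is enough that it
    contains the truncation of every feasible one.\<close>
  define K where "K = PiE UNIV (\<lambda>\<alpha>. {- B \<alpha>..B \<alpha>}) \<inter> F"
  have "closed F"
    unfolding F_def primal_feasible_def loewner_le_on_moment_matrix moment_matrix_def Ball_def
    by (intro closed_Collect_conj closed_Collect_all closed_Collect_imp closed_Collect_eq
        closed_psd_on continuous_intros open_Collect_const continuous_on_product_coordinates)
  then have "compact K"
    unfolding K_def by (intro compact_Int_closed compact_PiE_UNIV compact_Icc)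
  have trunc_F: "trunc \<phi> \<in> F \<and> trunc \<phi> 0 = \<phi> 0 \<and> \<psi> 0 = \<phi> 0 - d 0"
    if "primal_feasible \<mu> \<nu> n \<phi> \<psi>" for \<phi> \<psi>
  proof -
    have "\<psi> \<alpha> = \<phi> \<alpha> - d \<alpha>" if "\<alpha> \<in> multi_indices (2 * n)" for \<alpha>
      using \<open>primal_feasible \<mu> \<nu> n \<phi> \<psi>\<close> that
      by (force simp: primal_feasible_def d_def)
    moreover have "0 \<in> (multi_indices (2 * n) :: 'n multi_index set)"
      by (simp add: multi_indices_def)
    moreover from calculation have
      "primal_feasible \<mu> \<nu> n \<phi> \<psi> \<longleftrightarrow> primal_feasible \<mu> \<nu> n (trunc \<phi>) (\<lambda>\<alpha>. trunc \<phi> \<alpha> - d \<alpha>)"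
      by (intro primal_feasible_cong) (auto simp: trunc_def)
    ultimately show ?thesis
      using that by (auto simp: F_def trunc_def)
  qed
  have trunc_K: "trunc \<phi> \<in> K" if "primal_feasible \<mu> \<nu> n \<phi> \<psi>" for \<phi> \<psi>
  proof -
    \<comment> \<open>Truncation is idempotent, so \<open>B\<close> applied to
      \<open>trunc \<phi>\<close> bounds \<open>trunc \<phi>\<close> itself.\<close>
    have "\<bar>trunc \<phi> \<alpha>\<bar> \<le> B \<alpha>" for \<alpha>
      using B[of "trunc \<phi>" \<alpha>] trunc_F[OF that] by (simp add: trunc_def split: if_splits)
    then show ?thesis
      using trunc_F[OF that] by (auto simp: K_def abs_le_iff minus_le_iff)
  qed
  have "primal_feasible \<mu> \<nu> n (moment \<mu>) (moment \<nu>)"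
    using psd_on_moment_matrix_moment[OF \<mu>] psd_on_moment_matrix_moment[OF \<nu>]
    by (simp add: primal_feasible_def loewner_le_on_def psd_on_def)
  then have "K \<noteq> {}" using trunc_K by blast
  \<comment> \<open>With \<open>\<psi> = \<phi> - d\<close> the objective is
    \<open>2 * \<phi> 0 - d 0\<close>, so minimizing \<open>\<phi> 0\<close> suffices.\<close>
  moreover have "continuous_on K (\<lambda>\<phi>. \<phi> 0 :: real)"
    by (rule continuous_on_subset[OF continuous_on_product_coordinates]) simp
  ultimately obtain \<phi> where \<phi>: "\<phi> \<in> K" "\<And>\<phi>'. \<phi>' \<in> K \<Longrightarrow> \<phi> 0 \<le> \<phi>' 0"
    using continuous_attains_inf[OF \<open>compact K\<close>] by metis
  show thesis
  proof (rule that)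
    show "primal_feasible \<mu> \<nu> n \<phi> (\<lambda>\<alpha>. \<phi> \<alpha> - d \<alpha>)"
      using \<phi>(1) by (simp add: K_def F_def)
    show "primal_objective \<phi> (\<lambda>\<alpha>. \<phi> \<alpha> - d \<alpha>) \<le> primal_objective \<phi>' \<psi>'"
      if "primal_feasible \<mu> \<nu> n \<phi>' \<psi>'" for \<phi>' \<psi>'
      using \<phi>(2)[OF trunc_K[OF that]] trunc_F[OF that] by (simp add: primal_objective_def)
  qed
qed

theorem proposition3p2:
  fixes \<mu> \<nu> :: "(real ^ 'n::finite) measure" and c :: real
  assumes "finite_measure \<mu>" and "sets \<mu> = sets borel"
    and "finite_measure \<nu>" and "sets \<nu> = sets borel"
    and "\<And>\<alpha>. integrable \<mu> (monomial_at \<alpha>)"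
    and "\<And>\<alpha>. integrable \<nu> (monomial_at \<alpha>)"
    and "c > 0"
    and "\<And>i. integrable \<mu> (\<lambda>x. exp (c * \<bar>x $ i\<bar>))"
    and "\<And>i. integrable \<nu> (\<lambda>x. exp (c * \<bar>x $ i\<bar>))"
  shows "\<forall>n. (\<exists>\<phi> \<psi>. primal_feasible \<mu> \<nu> n \<phi> \<psi> \<and>
                 primal_value \<mu> \<nu> n = ereal (primal_objective \<phi> \<psi>)) \<and>
             primal_value \<mu> \<nu> n \<ge> dual_value \<mu> \<nu> n"
proof
  fix n
  obtain \<phi> \<psi> where opt: "primal_feasible \<mu> \<nu> n \<phi> \<psi>"
    "\<And>\<phi>' \<psi>'. primal_feasible \<mu> \<nu> n \<phi>' \<psi>' \<Longrightarrow> primal_objective \<phi> \<psi> \<le> primal_objective \<phi>' \<psi>'"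
    using primal_attained[OF assms(5,6)] by metis
  have value_eq: "primal_value \<mu> \<nu> n = ereal (primal_objective \<phi> \<psi>)"
    unfolding primal_value_def using opt by (intro antisym Inf_lower Inf_greatest) auto
  \<comment> \<open>Comparing all dual points with the single optimal primal pair is enough.\<close>
  moreover have "dual_value \<mu> \<nu> n \<le> ereal (primal_objective \<phi> \<psi>)"
    unfolding dual_value_def by (rule Sup_least) (auto intro: weak_duality[OF assms(5,6) opt(1)])
  ultimately show "(\<exists>\<phi> \<psi>. primal_feasible \<mu> \<nu> n \<phi> \<psi> \<and>
                 primal_value \<mu> \<nu> n = ereal (primal_objective \<phi> \<psi>)) \<and>
             primal_value \<mu> \<nu> n \<ge> dual_value \<mu> \<nu> n"
    using opt(1) by auto
qed

end
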